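(* Let $X$ be a set, $f:X\to X$ a self-map, and equip $X$ with the primal topology $\tau_f$ induced by $f$. Then $f$ is transitive if and only if $X$ consists of a single periodic orbit of $f$.
   Context: $\mathbb{N}$ is the set of non-negative integers. The primal topology induced by $f$ on $X$ is $\tau_f=\{A\subseteq X: f^{-1}(A)\subseteq A\}$. A point $x\in X$ is a transitive point of $f$ if for every non-empty open set $U$ and every $n\in\mathbb{N}$ there is $k\ge n$ such that $f^k(x)\in U$; $f$ is transitive if it has a transitive point. A periodic orbit is a set $\mathcal{O}(x)=\{f^k(x):k\in\mathbb{N}\}$ with $f^k(x)=x$ for some positive integer $k$. *)

theory Defs
  imports "HOL-Analysis.Abstract_Topology" "HOL-Library.FuncSet"
begin

text \<open>A set with a self-map is rendered as a carrier set \<open>X\<close> and a total function \<open>f\<close> with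
  \<open>f \<in> X \<rightarrow> X\<close>; values of \<open>f\<close> outside \<open>X\<close> play no role. In particular the preimage of \<open>A\<close> is
  taken within \<open>X\<close>.\<close>

definition primal_topology :: "'a set \<Rightarrow> ('a \<Rightarrow> 'a) \<Rightarrow> 'a topology" where
  "primal_topology X f = topology (\<lambda>A. A \<subseteq> X \<and> f -` A \<inter> X \<subseteq> A)"

lemma istopology_primal: "istopology (\<lambda>A. A \<subseteq> X \<and> f -` A \<inter> X \<subseteq> A)"
  unfolding istopology_def by blast

lemma openin_primal_topology:
  "openin (primal_topology X f) A \<longleftrightarrow> A \<subseteq> X \<and> f -` A \<inter> X \<subseteq> A"
  unfolding primal_topology_def by (simp add: topology_inverse'[OF istopology_primal])

lemma topspace_primal_topology: "topspace (primal_topology X f) = X"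
  unfolding topspace_def openin_primal_topology by blast

definition transitive_point :: "'a topology \<Rightarrow> ('a \<Rightarrow> 'a) \<Rightarrow> 'a \<Rightarrow> bool" where
  "transitive_point T f x \<longleftrightarrow> x \<in> topspace T \<and>
     (\<forall>U. openin T U \<and> U \<noteq> {} \<longrightarrow> (\<forall>n::nat. \<exists>k\<ge>n. (f ^^ k) x \<in> U))"

definition transitive_map :: "'a topology \<Rightarrow> ('a \<Rightarrow> 'a) \<Rightarrow> bool" where
  "transitive_map T f \<longleftrightarrow> (\<exists>x. transitive_point T f x)"

definition forward_orbit :: "('a \<Rightarrow> 'a) \<Rightarrow> 'a \<Rightarrow> 'a set" where
  "forward_orbit f x = {(f ^^ k) x | k::nat. True}"

definition periodic_orbit :: "'a set \<Rightarrow> ('a \<Rightarrow> 'a) \<Rightarrow> 'a set \<Rightarrow> bool" where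
  "periodic_orbit X f P \<longleftrightarrow>
     (\<exists>x\<in>X. (\<exists>k::nat. k > 0 \<and> (f ^^ k) x = x) \<and> P = forward_orbit f x)"

end

(* The backward orbit of a point y is an open neighbourhood of y, so a transitive point meets it
   arbitrarily late and hence visits y itself arbitrarily late. Applied to every y, this puts X in
   the orbit; applied to the transitive point itself, it gives periodicity. Conversely, a periodic
   point visits each point of its orbit infinitely often. *)
theory Submission
  imports Defs
begin

text \<open>If \<open>f z\<close> reaches \<open>y\<close> in \<open>m\<close> steps, then
  \<open>z\<close> reaches it in \<open>Suc m\<close> steps, so the set absorbs its
  preimage.\<close>

lemma openin_backward_orbit:
  "openin (primal_topology X f) {z \<in> X. \<exists>m. (f ^^ m) z = y}"
proof -
  have "\<exists>m. (f ^^ m) z = y" if "(f ^^ m) (f z) = y" for z m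
    using that by (intro exI[of _ "Suc m"]) (simp add: funpow_swap1)
  then show ?thesis
    unfolding openin_primal_topology by blast
qed

text \<open>Strengthens meeting open sets to hitting points: once the orbit enters the backward
  orbit of \<open>y\<close> at a time \<open>k \<ge> n\<close>, some \<open>m\<close> further steps
  lead to \<open>y\<close> itself, at time \<open>m + k \<ge> n\<close>.\<close>

lemma transitive_point_returns:
  assumes x: "transitive_point (primal_topology X f) f x" and "y \<in> X"
  obtains k where "k \<ge> n" "(f ^^ k) x = y"
proof -
  let ?U = "{z \<in> X. \<exists>m. (f ^^ m) z = y}"
  \<comment> \<open>The witness \<open>m = 0\<close> makes the backward orbit non-empty.\<close>
  have "(f ^^ 0) y = y" by simp
  then have "y \<in> ?U" using \<open>y \<in> X\<close> by blast
  then obtain k where k: "k \<ge> n" "(f ^^ k) x \<in> ?U"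
    using x openin_backward_orbit[of X f y] unfolding transitive_point_def by blast
  then obtain m where "(f ^^ m) ((f ^^ k) x) = y" by blast
  then have "(f ^^ (m + k)) x = y" by (simp add: funpow_add)
  with k show thesis by (intro that[of "m + k"]) auto
qed

lemma forward_orbit_subset:
  assumes "f \<in> X \<rightarrow> X" "x \<in> X"
  shows "forward_orbit f x \<subseteq> X"
proof -
  have "(f ^^ k) x \<in> X" for k
    using assms by (induction k) auto
  then show ?thesis
    unfolding forward_orbit_def by blast
qed

text \<open>Running through \<open>n\<close> full periods before the \<open>j\<close> steps from
  \<open>x\<close> to \<open>y\<close> delays the visit to time \<open>j + n * p\<close>, which is
  at least \<open>n\<close> because \<open>p > 0\<close>.\<close>

lemma periodic_point_returns:
  assumes "p > 0" "(f ^^ p) x = x" "y \<in> forward_orbit f x"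
  obtains k where "k \<ge> n" "(f ^^ k) x = y"
proof -
  obtain j where j: "y = (f ^^ j) x"
    using assms(3) unfolding forward_orbit_def by blast
  have "(f ^^ (n * p)) x = x"
    using funpow_mod_eq[OF assms(2), of "n * p"] by simp
  then have "(f ^^ (j + n * p)) x = y"
    by (simp add: funpow_add j)
  moreover have "n \<le> j + n * p"
    using \<open>p > 0\<close> by (simp add: trans_le_add2)
  ultimately show thesis by (rule that[rotated])
qed

theorem theorem12:
  fixes X :: "'a set" and f :: "'a \<Rightarrow> 'a"
  assumes "f \<in> X \<rightarrow> X"
  shows "transitive_map (primal_topology X f) f \<longleftrightarrow> periodic_orbit X f X"
proof
  assume "transitive_map (primal_topology X f) f"
  then obtain x where x: "transitive_point (primal_topology X f) f x"
    unfolding transitive_map_def by blast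
  then have "x \<in> X"
    by (simp add: transitive_point_def topspace_primal_topology)
  \<comment> \<open>Asking for a return at time at least 1 excludes the trivial one at time
    0.\<close>
  obtain k where "k \<ge> 1" "(f ^^ k) x = x"
    using transitive_point_returns[OF x \<open>x \<in> X\<close>] .
  then have "\<exists>k>0. (f ^^ k) x = x"
    by (intro exI[of _ k]) simp
  moreover have "X \<subseteq> forward_orbit f x"
  proof
    fix y assume "y \<in> X"
    then obtain k where "(f ^^ k) x = y"
      using transitive_point_returns[OF x] by blast
    then show "y \<in> forward_orbit f x"
      unfolding forward_orbit_def by blast
  qed
  ultimately show "periodic_orbit X f X"
    using forward_orbit_subset[OF assms \<open>x \<in> X\<close>] \<open>x \<in> X\<close>
    unfolding periodic_orbit_def by blast
next
  assume "periodic_orbit X f X"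
  then obtain x p where x: "x \<in> X" "p > 0" "(f ^^ p) x = x" "X = forward_orbit f x"
    unfolding periodic_orbit_def by blast
  have "\<exists>k\<ge>n. (f ^^ k) x \<in> U"
    if U: "openin (primal_topology X f) U" "U \<noteq> {}" for U n
  proof -
    \<comment> \<open>Open sets lie inside \<open>X\<close>, which here is the orbit of
      \<open>x\<close>, so every point of \<open>U\<close> is visited.\<close>
    obtain y where "y \<in> U" "y \<in> forward_orbit f x"
      using U x(4) unfolding openin_primal_topology by blast
    then show ?thesis
      using periodic_point_returns[OF x(2,3)] by metis
  qed
  then show "transitive_map (primal_topology X f) f"
    using x(1) unfolding transitive_map_def transitive_point_def topspace_primal_topology by blast
qed

end
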